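(* Let $f:\mathcal X\to\mathbb R$ be convex and continuously differentiable, attaining its minimum at $x^\ast$. Let $1<p\le\infty$ and $0<\delta<\infty$, and let $(x_k)_{k\ge0}$ be the iterates of a $\delta$-descent algorithm of order $p$ for $f$. Put $E_0:=f(x_0)-f(x^\ast)$ and $c_p:=\frac{(1-1/p)^p}{p-1}$, and suppose $R:=\sup_{x:\,f(x)\le f(x_0)}\|x-x^\ast\|<\infty$. Set $\gamma=1$ if descent condition (i) of the context holds, and $\gamma=\left(1+\frac{1}{Rp}\left(\frac{E_0}{c_p}\right)^{\frac1p}\delta^{\frac{p-1}{p}}\right)^{p-1}$ if descent condition (ii) holds (read, for $p=\infty$, as its limit $\gamma=e^{\delta/R}$). Then for every $k\ge 0$, $$f(x_k)-f(x^\ast)\le\begin{cases}2\left(\dfrac{1}{E_0^{1/p}}+\dfrac{1}{R\,\gamma\, c_p^{1/p}\,p}(\delta k)^{\frac{p-1}{p}}\right)^{-p},& p<\infty,\\[2mm] 2E_0\exp\left(-\delta k/(R\gamma)\right),&p=\infty.\end{cases}$$ In particular, for $p<\infty$ the right-hand side is $O\left(1/\left(1+\frac{1}{R\gamma p}(\delta k)^{\frac{p-1}{p}}\right)^{p}\right)$.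
   Context: $\mathcal X$ is a finite-dimensional real vector space with norm $\|v\|=\sqrt{\langle v,Bv\rangle}$ and dual norm $\|s\|_\ast=\sqrt{\langle s,B^{-1}s\rangle}$ on $\mathcal X^\ast$, where $B:\mathcal X\to\mathcal X^\ast$ is a positive definite self-adjoint operator. An algorithm $x_{k+1}=\mathcal A(x_k)$ is a $\delta$-descent algorithm of order $p$ (with $1<p\le\infty$, $0<\delta<\infty$) if it satisfies either (i) $\frac{f(x_{k+1})-f(x_k)}{\delta}\le-\|\nabla f(x_k)\|_\ast^{\frac{p}{p-1}}$ for all $k\ge0$, or (ii) $\frac{f(x_{k+1})-f(x_k)}{\delta}\le-\|\nabla f(x_{k+1})\|_\ast^{\frac{p}{p-1}}$ for all $k\ge0$. For $p=\infty$, $\frac{p}{p-1}=1$. If $E_0=0$, the bound is read as $0$. *)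

theory Defs
  imports "HOL-Analysis.Analysis"
begin

(* Finite dimension is an explicit predicate, so the zero space is included. The dual space is
   'a \<Rightarrow>\<^sub>L real: in finite dimension every linear functional is bounded. The type-class norm
   only provides the (unique) vector-space topology for differentiability and continuity;
   all metric quantities use the norms induced by B. *)

definition finite_dimensional :: "'a::real_vector itself \<Rightarrow> bool" where
  "finite_dimensional _ \<longleftrightarrow> (\<exists>S::'a set. finite S \<and> span S = UNIV)"

definition pos_def_self_adjoint :: "('a::real_normed_vector \<Rightarrow> ('a \<Rightarrow>\<^sub>L real)) \<Rightarrow> bool" where
  "pos_def_self_adjoint B \<longleftrightarrow>
     linear B \<and> (\<forall>u v. blinfun_apply (B u) v = blinfun_apply (B v) u) \<and>
     (\<forall>v. v \<noteq> 0 \<longrightarrow> 0 < blinfun_apply (B v) v)"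

definition primal_norm :: "('a::real_normed_vector \<Rightarrow> ('a \<Rightarrow>\<^sub>L real)) \<Rightarrow> 'a \<Rightarrow> real" where
  "primal_norm B v = sqrt (blinfun_apply (B v) v)"

(* In finite dimension a positive definite B is bijective, so inv B is its genuine inverse. *)
definition dual_norm :: "('a::real_normed_vector \<Rightarrow> ('a \<Rightarrow>\<^sub>L real)) \<Rightarrow> ('a \<Rightarrow>\<^sub>L real) \<Rightarrow> real" where
  "dual_norm B s = sqrt (blinfun_apply s (inv B s))"

definition conj_exponent :: "ereal \<Rightarrow> real" where
  "conj_exponent p = (if p = \<infinity> then 1 else real_of_ereal p / (real_of_ereal p - 1))"

definition explicit_descent ::
  "('a::real_normed_vector \<Rightarrow> ('a \<Rightarrow>\<^sub>L real)) \<Rightarrow> ('a \<Rightarrow> real) \<Rightarrow> ('a \<Rightarrow> ('a \<Rightarrow>\<^sub>L real)) \<Rightarrow>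
   real \<Rightarrow> ereal \<Rightarrow> (nat \<Rightarrow> 'a) \<Rightarrow> bool" where
  "explicit_descent B f f' \<delta> p x \<longleftrightarrow>
     (\<forall>k. (f (x (Suc k)) - f (x k)) / \<delta> \<le> - (dual_norm B (f' (x k)) powr conj_exponent p))"

definition implicit_descent ::
  "('a::real_normed_vector \<Rightarrow> ('a \<Rightarrow>\<^sub>L real)) \<Rightarrow> ('a \<Rightarrow> real) \<Rightarrow> ('a \<Rightarrow> ('a \<Rightarrow>\<^sub>L real)) \<Rightarrow>
   real \<Rightarrow> ereal \<Rightarrow> (nat \<Rightarrow> 'a) \<Rightarrow> bool" where
  "implicit_descent B f f' \<delta> p x \<longleftrightarrow>
     (\<forall>k. (f (x (Suc k)) - f (x k)) / \<delta> \<le> - (dual_norm B (f' (x (Suc k))) powr conj_exponent p))"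

definition c_const :: "real \<Rightarrow> real" where
  "c_const p = (1 - 1 / p) powr p / (p - 1)"

(* For p = \<infinity> this is the limit of the finite-p formula. *)
definition implicit_gamma :: "real \<Rightarrow> real \<Rightarrow> real \<Rightarrow> ereal \<Rightarrow> real" where
  "implicit_gamma E0 R \<delta> p =
     (if p = \<infinity> then exp (\<delta> / R)
      else let r = real_of_ereal p in
        (1 + 1 / (R * r) * (E0 / c_const r) powr (1 / r) * \<delta> powr ((r - 1) / r)) powr (r - 1))"

(* E0 = 0 is split off because 1 / 0 = 0, whereas the intended reading of the bound is then 0.
   If E0 > 0 then R > 0 in the intended use. *)
definition rate_bound :: "real \<Rightarrow> real \<Rightarrow> real \<Rightarrow> real \<Rightarrow> ereal \<Rightarrow> nat \<Rightarrow> real" where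
  "rate_bound E0 R \<gamma> \<delta> p k =
     (if E0 = 0 then 0
      else if p = \<infinity> then 2 * E0 * exp (- (\<delta> * real k) / (R * \<gamma>))
      else let r = real_of_ereal p in
        2 * (1 / E0 powr (1 / r)
             + 1 / (R * \<gamma> * c_const r powr (1 / r) * r) * (\<delta> * real k) powr ((r - 1) / r)) powr (- r))"

definition rate_order :: "real \<Rightarrow> real \<Rightarrow> real \<Rightarrow> real \<Rightarrow> nat \<Rightarrow> real" where
  "rate_order R \<gamma> \<delta> r k =
     1 / (1 + 1 / (R * \<gamma> * r) * (\<delta> * real k) powr ((r - 1) / r)) powr r"

end

(* Convexity and Cauchy-Schwarz give E_k := f(x_k) - f(x_min) <= R ||f'(x_k)||_*, so descent turns into
   a scalar recursion. With e_k = E_k / E_0, 1/p + 1/q = 1 and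
   w = E_0^(1/p) ((q - 1) delta)^(1/q) / R it reads e_{k+1} <= e_k - w^q/(q - 1) e^q, where e is
   e_k (explicit) or e_{k+1} (implicit), gamma is (1 + w)^(p-1) in the implicit case, and the claim
   is e_k <= 2 (1 + X_k)^(-p) with X_k = w k^(1/q) / gamma.

   Explicit: e_k^(1-q) grows by at least w^q per step, so e_k^(1-q) >= 1 + X_k^q, and the power mean
   inequality (1 + X)^q <= 2^(q-1) (1 + X^q) produces the factor 2.

   Implicit with w <= 1: the same argument, the growth per step being at least w^q (1 + w)^(-p).

   Implicit with w > 1: this per-step growth can fail at first. As long as X_k <= w, the telescoped
   estimate e_k + k w^q/(q - 1) e_k^q <= 1 suffices. Once X_{k+1} > w, that is k + 1 > (1 + w)^p,
   the claimed bound is a supersolution of the recursion and propagates by induction. *)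

theory Submission
  imports Defs
begin

section \<open>Tangent-line inequalities for real powers\<close>

lemma powr_ge_tangent_nonpos:
  fixes x b :: real
  assumes "0 < x" "b \<le> 0"
  shows "1 + b * (x - 1) \<le> x powr b"
proof -
  have "b * (x - 1) \<le> b * ln x"
    using assms ln_le_minus_one by (intro mult_left_mono_neg) auto
  then show ?thesis
    using exp_ge_add_one_self[of "b * ln x"] assms by (simp add: powr_def del: exp_ge_add_one_self)
qed

text \<open>After a factor \<open>x\<close> is pulled out, this is the previous inequality at the
  point \<open>1 / x\<close> with the exponent \<open>1 - b \<le> 0\<close>.\<close>

lemma powr_ge_tangent_ge_1:
  fixes x b :: real
  assumes "0 \<le> x" "1 \<le> b"
  shows "1 + b * (x - 1) \<le> x powr b"
proof (cases "x = 0")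
  case False
  then have "x > 0" using assms by simp
  have "1 + b * (x - 1) = x * (1 + (1 - b) * (1 / x - 1))"
    using \<open>x > 0\<close> by (simp add: field_simps)
  also have "\<dots> \<le> x * (1 / x) powr (1 - b)"
    using powr_ge_tangent_nonpos[of "1 / x" "1 - b"] assms \<open>x > 0\<close>
    by (intro mult_left_mono) auto
  also have "\<dots> = x powr b"
    using \<open>x > 0\<close> by (simp add: powr_divide powr_diff field_simps)
  finally show ?thesis .
qed (use assms in simp)

lemma powr_le_tangent:
  fixes x b :: real
  assumes "0 \<le> x" "0 < b" "b \<le> 1"
  shows "x powr b \<le> 1 + b * (x - 1)"
proof -
  have "1 + (1 / b) * (x powr b - 1) \<le> (x powr b) powr (1 / b)"
    using assms by (intro powr_ge_tangent_ge_1) auto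
  also have "\<dots> = x" using assms by (simp add: powr_powr)
  finally show ?thesis using assms by (simp add: field_simps)
qed

text \<open>Used with \<open>a = q - 1\<close>, where \<open>1 + 1 / a = p\<close>. For
  \<open>a \<ge> 1\<close>, Bernoulli's (1 + s)^a \<ge> 1 + a s makes the right side at least a s /
  (1 + a s). For \<open>a < 1\<close>, the tangent of y^(-a) at y = 1, taken at 1 / (1 + s), makes
  it at least a s (1 + s)^(-1-a), and (1 + s)^a \<le> 1 + a s converts the base.\<close>

lemma one_minus_powr_neg_ge:
  fixes a s :: real
  assumes "0 < a" "0 \<le> s"
  shows "a * s * (1 + a * s) powr - (1 + 1 / a) \<le> 1 - (1 + s) powr - a"
proof (cases "1 \<le> a")
  case True
  have pos: "0 < 1 + a * s" using assms by (simp add: add_pos_nonneg)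
  have "1 + a * s \<le> (1 + s) powr a"
    using powr_ge_tangent_ge_1[of "1 + s" a] assms True by simp
  then have "(1 + s) powr - a \<le> 1 / (1 + a * s)"
    using pos assms by (simp add: powr_minus_divide frac_le)
  then have "a * s / (1 + a * s) \<le> 1 - (1 + s) powr - a"
    using pos by (simp add: field_simps)
  moreover have "(1 + a * s) powr - (1 + 1 / a) \<le> (1 + a * s) powr - 1"
    using assms by (intro powr_mono) auto
  then have "a * s * (1 + a * s) powr - (1 + 1 / a) \<le> a * s * (1 / (1 + a * s))"
    using assms pos by (intro mult_left_mono) (auto simp: powr_minus_divide)
  ultimately show ?thesis by simp
next
  case False
  have "1 + a * s / (1 + s) = 1 + (- a) * (1 / (1 + s) - 1)"
    using assms by (simp add: field_simps)
  also have "\<dots> \<le> (1 / (1 + s)) powr - a"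
    using assms by (intro powr_ge_tangent_nonpos) auto
  also have "\<dots> = (1 + s) powr a"
    using assms by (simp add: powr_divide powr_minus_divide)
  finally have "(1 + a * s / (1 + s)) * (1 + s) powr - a \<le> (1 + s) powr a * (1 + s) powr - a"
    by (intro mult_right_mono) auto
  also have "\<dots> = 1" using assms by (simp flip: powr_add)
  finally have 1: "a * s * ((1 + s) powr - a / (1 + s)) \<le> 1 - (1 + s) powr - a"
    by (simp add: algebra_simps)
  have "(1 + s) powr (1 + a) = ((1 + s) powr a) powr (1 + 1 / a)"
    using assms by (simp add: powr_powr distrib_left add.commute)
  also have "\<dots> \<le> (1 + a * s) powr (1 + 1 / a)"
    using powr_le_tangent[of "1 + s" a] assms False by (intro powr_mono2) auto
  finally have "1 / (1 + a * s) powr (1 + 1 / a) \<le> 1 / (1 + s) powr (1 + a)"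
    using assms by (intro divide_left_mono) (auto simp: add_nonneg_eq_0_iff intro!: mult_pos_pos)
  also have "\<dots> = (1 + s) powr - a / (1 + s)"
    using assms by (simp add: powr_add powr_minus_divide)
  finally have "(1 + a * s) powr - (1 + 1 / a) \<le> (1 + s) powr - a / (1 + s)"
    by (simp only: powr_minus_divide)
  then have "a * s * (1 + a * s) powr - (1 + 1 / a) \<le> a * s * ((1 + s) powr - a / (1 + s))"
    using assms by (intro mult_left_mono) auto
  with 1 show ?thesis by linarith
qed

section \<open>Conjugate exponents and the explicit recursion for finite p\<close>

locale conjugate_exponents =
  fixes p q :: real
  assumes p_gt_1: "1 < p" and q_gt_1: "1 < q" and conj: "(p - 1) * (q - 1) = 1"
begin

lemma exponent_identities:
  "p * q = p + q" "(p - 1) * q = p" "p * (q - 1) = q" "1 + 1 / (q - 1) = p"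
  "1 / (q - 1) = p - 1" "p / q = p - 1" "q / p = q - 1"
  using conj p_gt_1 q_gt_1 by (simp_all add: field_simps)

lemma half_power_mean:
  assumes "0 \<le> X"
  shows "(1 + X) powr q \<le> 2 powr (q - 1) * (1 + X powr q)"
proof (cases "X = 0")
  case False
  have "((1 + X) / 2) powr q \<le> (1 + X powr q) / 2"
    using convex_onD[OF powr_convex[of q], of "1 / 2" 1 X] False assms q_gt_1
    by (simp add: field_simps)
  then show ?thesis
    using assms by (simp add: powr_divide powr_diff field_simps)
qed (use q_gt_1 in \<open>simp add: ge_one_powr_ge_zero\<close>)

text \<open>The power mean inequality is raised to the power \<open>p - 1\<close>. As (p - 1)(q - 1)
  = 1, the factor \<open>2 powr (q - 1)\<close> becomes 2 and \<open>e powr - (q - 1)\<close>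
  becomes 1 / e.\<close>

lemma le_bound_of_powr_ge:
  assumes "0 < e" "0 \<le> X" "1 + X powr q \<le> e powr - (q - 1)"
  shows "e \<le> 2 * (1 + X) powr - p"
proof -
  have "(1 + X) powr q \<le> 2 powr (q - 1) * e powr - (q - 1)"
    using half_power_mean[OF assms(2)] assms(3)
    by (meson mult_left_mono order_trans powr_ge_zero)
  then have "((1 + X) powr q) powr (p - 1) \<le> (2 powr (q - 1) * e powr - (q - 1)) powr (p - 1)"
    using p_gt_1 by (intro powr_mono2) auto
  also have "\<dots> = 2 powr ((p - 1) * (q - 1)) * e powr - ((p - 1) * (q - 1))"
    by (simp add: powr_mult powr_powr algebra_simps)
  also have "\<dots> = 2 / e"
    using assms by (simp only: conj) (simp add: powr_minus_divide)
  also have "((1 + X) powr q) powr (p - 1) = (1 + X) powr p"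
    using exponent_identities(2) by (simp add: powr_powr mult.commute)
  finally show ?thesis
    using assms by (simp add: powr_minus_divide field_simps)
qed

text \<open>The tangent of y^(-(q-1)) at y = 1, evaluated at \<open>g / e\<close>. Its slope cancels
  the denominator of \<open>c / (q - 1)\<close>, so the gain per step is exactly
  \<open>c\<close>.\<close>

lemma explicit_step:
  assumes "0 < g" "0 < e" "g \<le> e - c / (q - 1) * e powr q"
  shows "e powr - (q - 1) + c \<le> g powr - (q - 1)"
proof -
  let ?a = "q - 1"
  have a: "?a > 0" using q_gt_1 by simp
  have "g / e \<le> (e - c / ?a * e powr q) / e"
    using assms by (intro divide_right_mono) auto
  also have "\<dots> = 1 - c / ?a * e powr ?a"
    using assms by (simp add: powr_diff diff_divide_distrib)
  finally have "c / ?a * e powr ?a \<le> 1 - g / e" by simp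
  then have "?a * (c / ?a * e powr ?a) \<le> ?a * (1 - g / e)"
    using a by (intro mult_left_mono) auto
  moreover have "?a * (c / ?a * e powr ?a) = c * e powr ?a" using a by simp
  moreover have "?a * (1 - g / e) = - ?a * (g / e - 1)"
    by (metis minus_diff_eq mult_minus_left mult_minus_right)
  ultimately have "1 + c * e powr ?a \<le> 1 + - ?a * (g / e - 1)" by (simp only: add_left_mono)
  also have "\<dots> \<le> (g / e) powr - ?a"
    using assms a by (intro powr_ge_tangent_nonpos) auto
  finally have "(1 + c * e powr ?a) * e powr - ?a \<le> (g / e) powr - ?a * e powr - ?a"
    by (intro mult_right_mono) auto
  also have "\<dots> = g powr - ?a" using assms by (simp add: powr_divide)
  also have "(1 + c * e powr ?a) * e powr - ?a = e powr - ?a + c * (e powr ?a * e powr - ?a)"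
    by (simp add: algebra_simps)
  also have "e powr ?a * e powr - ?a = 1"
    using assms by (simp flip: powr_add)
  finally show ?thesis by simp
qed

lemma explicit_rate:
  assumes "\<And>k. 0 \<le> e k" "e 0 = 1" "0 \<le> w"
    and step: "\<And>k. e (Suc k) \<le> e k - w powr q / (q - 1) * e k powr q"
  shows "e k \<le> 2 * (1 + w * real k powr (1 / q)) powr - p"
proof (cases "e k = 0")
  case False
  then have "0 < e k" using assms(1)[of k] by simp
  then have "1 + w powr q * real k \<le> e k powr - (q - 1)"
  proof (induction k)
    case (Suc k)
    have "0 \<le> w powr q / (q - 1) * e k powr q" using q_gt_1 by simp
    \<comment> \<open>The induction carries positivity as a premise; it passes down from
      \<open>Suc k\<close> to \<open>k\<close> because the sequence is nonincreasing.\<close>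
    then have "0 < e k" using Suc.prems step[of k] by linarith
    then show ?case
      using explicit_step[OF Suc.prems _ step] Suc.IH by (simp add: algebra_simps)
  qed (simp add: assms)
  moreover have "(w * real k powr (1 / q)) powr q = w powr q * real k"
    using q_gt_1 assms by (simp add: powr_mult powr_powr)
  ultimately show ?thesis
    using \<open>0 < e k\<close> assms by (intro le_bound_of_powr_ge) auto
qed simp

section \<open>The implicit recursion for finite p\<close>

lemma implicit_step:
  assumes "0 < g" "g \<le> 1" "0 \<le> w" "w \<le> 1" "g + w powr q / (q - 1) * g powr q \<le> e"
  shows "e powr - (q - 1) + w powr q * (1 + w) powr - p \<le> g powr - (q - 1)"
proof -
  let ?a = "q - 1"
  \<comment> \<open>\<open>s\<close> is the relative drop forced by the recursion: \<open>e\<close>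
    is at least \<open>g * (1 + s)\<close>.\<close>
  define s where "s = w powr q / ?a * g powr ?a"
  have a: "?a > 0" using q_gt_1 by simp
  have s: "0 \<le> s" using a by (simp add: s_def)
  have as: "?a * s = w powr q * g powr ?a" using a by (simp add: s_def)
  \<comment> \<open>\<open>w \<le> 1\<close> gives w^q \<le> w, and \<open>g \<le> 1\<close> removes
    the other factor. Hence \<open>?a * s \<le> w\<close>, which makes the loss factor (1 + w)^(-p)
    below independent of \<open>g\<close>.\<close>
  have "w powr q \<le> w powr 1" using assms q_gt_1 by (intro powr_mono') auto
  moreover have "g powr ?a \<le> 1" using assms a by (intro powr_le1) auto
  then have "w powr q * g powr ?a \<le> w powr q * 1" by (intro mult_left_mono) auto
  ultimately have as_le: "?a * s \<le> w" using assms as by simp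
  have "g * (1 + s) = g + w powr q / ?a * g powr q"
    using assms(1) by (simp add: s_def powr_diff distrib_left)
  then have "g * (1 + s) \<le> e" using assms(5) by simp
  then have "e powr - ?a \<le> (g * (1 + s)) powr - ?a"
    using assms s a by (intro powr_mono2') auto
  also have "\<dots> = g powr - ?a * (1 + s) powr - ?a"
    by (simp add: powr_mult)
  also have "\<dots> \<le> g powr - ?a * (1 - ?a * s * (1 + w) powr - p)"
  proof (intro mult_left_mono)
    have "(1 + w) powr - p \<le> (1 + ?a * s) powr - p"
      using as_le a s p_gt_1 by (intro powr_mono2') (auto simp: add_pos_nonneg)
    then have "?a * s * (1 + w) powr - p \<le> ?a * s * (1 + ?a * s) powr - p"
      using a s by (intro mult_left_mono) auto
    also have "\<dots> \<le> 1 - (1 + s) powr - ?a"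
      using one_minus_powr_neg_ge[OF a s] by (simp only: exponent_identities(4))
    finally show "(1 + s) powr - ?a \<le> 1 - ?a * s * (1 + w) powr - p" by simp
  qed simp
  also have "\<dots> = g powr - ?a - (g powr ?a * g powr - ?a) * (w powr q * (1 + w) powr - p)"
    unfolding as by (simp add: algebra_simps)
  also have "g powr ?a * g powr - ?a = 1" using assms by (simp flip: powr_add)
  finally show ?thesis by simp
qed

text \<open>For \<open>t = real k\<close> the base is X_k with the implicit \<gamma>. Since (p - 1)
  q = p, its q-th power grows linearly in k, by exactly the gain per step in
  \<open>implicit_step\<close>.\<close>

lemma quotient_powr:
  assumes "0 \<le> w" "0 \<le> t"
  shows "(w * t powr (1 / q) / (1 + w) powr (p - 1)) powr q = w powr q * t * (1 + w) powr - p"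
  using assms q_gt_1 exponent_identities(2)
  by (simp add: powr_mult powr_divide powr_powr powr_minus_divide)

text \<open>The sum of the tangent of the first summand at \<open>X = 1\<close> and that of the second at \<open>X = 0\<close>,
  both as functions of \<open>1 / (1 + X)\<close>, is the constant 1.\<close>

lemma two_tangents:
  assumes "0 \<le> X"
  shows "1 \<le> (2 * X / (1 + X)) powr q / (q - 1) + 2 * (1 + X) powr - p"
proof -
  have a: "q - 1 > 0" using q_gt_1 by simp
  have "1 + q * (2 * X / (1 + X) - 1) \<le> (2 * X / (1 + X)) powr q"
    using assms q_gt_1 by (intro powr_ge_tangent_ge_1) auto
  then have "(1 + q * (2 * X / (1 + X) - 1)) / (q - 1) \<le> (2 * X / (1 + X)) powr q / (q - 1)"
    using a by (intro divide_right_mono) auto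
  moreover have "1 + p * (1 / (1 + X) - 1) \<le> (1 / (1 + X)) powr p"
    using assms p_gt_1 by (intro powr_ge_tangent_ge_1) auto
  then have "1 + p * (1 / (1 + X) - 1) \<le> (1 + X) powr - p"
    using assms by (simp add: powr_divide powr_minus_divide)
  moreover have "(1 + q * (2 * X / (1 + X) - 1)) / (q - 1) + 2 * (1 + p * (1 / (1 + X) - 1)) = 1"
  proof -
    have p: "p = q / (q - 1)" using exponent_identities(3) a by (simp add: field_simps)
    define u where "u = X / (1 + X)"
    have u: "2 * X / (1 + X) = 2 * u" "1 / (1 + X) = 1 - u"
      using assms by (simp_all add: u_def field_simps)
    have "(1 + q * (2 * u - 1)) / (q - 1) = 2 * p * u - 1"
      using a by (simp add: p field_simps)
    moreover have "p = 1 + 1 / (q - 1)" by (simp only: exponent_identities(4))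
    ultimately show ?thesis unfolding u by (simp add: algebra_simps)
  qed
  ultimately show ?thesis by (smt (verit))
qed

text \<open>The map y -> y + k w^q/(q - 1) y^q is increasing, so it is enough that its value at the
  claimed bound \<open>G\<close> is at least 1. This follows from \<open>two_tangents\<close>, since
  \<open>X \<le> w\<close> makes the extra factor ((1 + w)/(1 + X))^p at least 1.\<close>

lemma bound_of_total_decrease:
  assumes "0 \<le> X" "X \<le> w" "0 \<le> k" "X powr q = w powr q * k * (1 + w) powr - p"
    and "0 \<le> e" "e + k * (w powr q / (q - 1)) * e powr q \<le> 1"
  shows "e \<le> 2 * (1 + X) powr - p"
proof (rule ccontr)
  define G where "G = 2 * (1 + X) powr - p"
  assume "\<not> ?thesis"
  then have G: "G < e" "0 < G" using assms by (auto simp: G_def)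
  have a: "0 < q - 1" using q_gt_1 by simp
  have "k * w powr q = X powr q * (1 + w) powr p"
    using assms by (simp add: powr_minus field_simps)
  \<comment> \<open>\<open>p * q = p + q\<close> splits the power of 1 + X contained in
    \<open>G powr q\<close>: one part stays as \<open>(1 + X) powr - p\<close>, the other joins the
    term of \<open>two_tangents\<close>.\<close>
  then have "k * w powr q * G powr q
      = (1 + w) powr p * (1 + X) powr - p * (2 * X / (1 + X)) powr q"
    using assms exponent_identities(1)
    by (simp add: G_def powr_mult powr_divide powr_powr powr_diff powr_minus_divide powr_add)
  moreover have "(1 + X) powr p \<le> (1 + w) powr p"
    using assms p_gt_1 by (intro powr_mono2) auto
  then have "1 \<le> (1 + w) powr p * (1 + X) powr - p"
    using assms by (simp add: powr_minus field_simps)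
  then have "1 * (2 * X / (1 + X)) powr q
      \<le> (1 + w) powr p * (1 + X) powr - p * (2 * X / (1 + X)) powr q"
    by (intro mult_right_mono) auto
  ultimately have "(2 * X / (1 + X)) powr q / (q - 1) \<le> k * w powr q * G powr q / (q - 1)"
    using a by (intro divide_right_mono) auto
  then have "1 \<le> k * w powr q * G powr q / (q - 1) + G"
    using two_tangents[OF assms(1)] by (simp add: G_def)
  moreover have "G powr q \<le> e powr q" using G q_gt_1 by (intro powr_mono2) auto
  then have "k * (w powr q / (q - 1)) * G powr q \<le> k * (w powr q / (q - 1)) * e powr q"
    using a assms by (intro mult_left_mono) auto
  ultimately show False using G assms by simp
qed

text \<open>The elementary inequality behind \<open>bound_step\<close>. For
  \<open>1 \<le> X\<close>, the bases compare directly and the factor 2X/(1 + X) is at least 1. For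
  \<open>X < 1\<close>, the left side is at most exp(p/(2k)) < 2, because p < k, while X^q (1 + w)^p
  = w^q k is at least 2.\<close>

lemma bound_step_factor:
  assumes "1 \<le> w" "0 < X" "2 \<le> k" "X powr q = w powr q * k * (1 + w) powr - p"
    and large: "(1 + w) powr p < k + 1"
  shows "(1 + X / (1 + X) / k) powr p \<le> (2 * X / (1 + X)) powr (q - 1) * (1 + w) powr p"
proof -
  have a: "0 < q - 1" using q_gt_1 by simp
  \<comment> \<open>The chain 1 + p \<le> 2^p \<le> (1 + w)^p < k + 1 yields p < k.\<close>
  have "1 + p * (2 - 1) \<le> 2 powr p" using p_gt_1 by (intro powr_ge_tangent_ge_1) auto
  also have "2 powr p \<le> (1 + w) powr p" using assms p_gt_1 by (intro powr_mono2) auto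
  finally have pk: "p < k" using large by simp
  show ?thesis
  proof (cases "1 \<le> X")
    case True
    have "X / (1 + X) / k \<le> 1 / 1"
      using assms by (intro frac_le) auto
    then have "X / (1 + X) / k \<le> w" using assms by linarith
    then have "(1 + X / (1 + X) / k) powr p \<le> (1 + w) powr p"
      using assms p_gt_1 by (intro powr_mono2 add_left_mono) auto
    also have "\<dots> = 1 * (1 + w) powr p" by simp
    also have "\<dots> \<le> (2 * X / (1 + X)) powr (q - 1) * (1 + w) powr p"
      using True a by (intro mult_right_mono ge_one_powr_ge_zero) auto
    finally show ?thesis .
  next
    case False
    have "X / (1 + X) / k \<le> 1 / 2 / k"
      using False assms by (intro divide_right_mono) (auto simp: field_simps)
    then have "(1 + X / (1 + X) / k) powr p \<le> (1 + 1 / 2 / k) powr p"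
      using assms p_gt_1 by (intro powr_mono2) auto
    also have "\<dots> = exp (p * ln (1 + 1 / 2 / k))"
      using assms by (simp add: powr_def add_nonneg_eq_0_iff)
    also have "\<dots> \<le> exp (p * (1 / 2 / k))"
      using assms p_gt_1 by (intro iffD2[OF exp_le_cancel_iff] mult_left_mono ln_add_one_self_le_self) auto
    also have "\<dots> \<le> exp (1 / 2)"
      using assms pk by (simp add: field_simps)
    also have "\<dots> \<le> 2"
    proof (rule power2_le_imp_le)
      \<comment> \<open>After squaring, e \<le> 3 suffices.\<close>
      show "(exp (1 / 2 :: real))\<^sup>2 \<le> 2\<^sup>2"
        using exp_le by (simp flip: exp_of_nat_mult)
    qed simp
    also have "2 \<le> w powr q * k"
    proof -
      have "1 * k \<le> w powr q * k"
        using assms q_gt_1 by (intro mult_right_mono ge_one_powr_ge_zero) auto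
      then show ?thesis using assms by linarith
    qed
    also have "\<dots> = X powr q * (1 + w) powr p"
      using assms by (simp add: powr_minus field_simps)
    also have "X powr q * (1 + w) powr p \<le> (2 * X / (1 + X)) powr (q - 1) * (1 + w) powr p"
    proof (intro mult_right_mono)
      have "X powr q \<le> X powr (q - 1)" using False assms by (intro powr_mono') auto
      also have "\<dots> \<le> (2 * X / (1 + X)) powr (q - 1)"
        using False assms a by (intro powr_mono2) (auto simp: field_simps)
      finally show "X powr q \<le> (2 * X / (1 + X)) powr (q - 1)" .
    qed simp
    finally show ?thesis .
  qed
qed

text \<open>Consecutive values of the claimed bound satisfy the recursion with the inequality
  reversed. Their difference is estimated by the tangent of t^(-p), with t the ratio of the bases 1
  + X' and 1 + X; the nonlinear term contains t^(-pq), which \<open>bound_step_factor\<close>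
  controls.\<close>

lemma bound_step:
  assumes "1 \<le> w" "0 < X" "0 < X'" "2 \<le> k" "X powr q = w powr q * k * (1 + w) powr - p"
    and "X' powr q = w powr q * (k + 1) * (1 + w) powr - p"
    and large: "(1 + w) powr p < k + 1"
  shows "2 * (1 + X) powr - p
    \<le> 2 * (1 + X') powr - p + w powr q / (q - 1) * (2 * (1 + X') powr - p) powr q"
proof -
  define A where "A = 1 + X"
  define t where "t = (1 + X') / A"
  define r where "r = (1 + 1 / k) powr (1 / q)"
  define Y where "Y = 2 * X / A"
  have a: "0 < q - 1" using q_gt_1 by simp
  have A: "0 < A" and t: "0 < t" and Y: "0 < Y"
    using assms by (simp_all add: A_def t_def Y_def)
  have X'_A: "1 + X' = A * t" using A by (simp add: t_def)
  have "X' = (X' powr q) powr (1 / q)" "X = (X powr q) powr (1 / q)"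
    using \<open>0 < X\<close> \<open>0 < X'\<close> q_gt_1 by (simp_all add: powr_powr)
  moreover have "X' powr q = X powr q * (1 + 1 / k)"
    unfolding assms using assms(4) by (simp add: field_simps)
  ultimately have X': "X' = X * r"
    by (simp add: r_def powr_mult)
  have r: "0 < r" "r powr q = 1 + 1 / k"
    using assms q_gt_1 add_pos_pos[of 1 "1 / k"] by (simp_all add: r_def powr_powr)
  \<comment> \<open>\<open>r\<close> is the ratio X'/X. Concavity of the power \<open>1 / q\<close>
    bounds \<open>r - 1\<close>, and with it \<open>t - 1\<close>.\<close>
  have "r \<le> 1 + 1 / q * (1 + 1 / k - 1)"
    unfolding r_def using assms q_gt_1 by (intro powr_le_tangent) auto
  then have r_le: "r - 1 \<le> 1 / (q * k)" by simp
  have "t - 1 = X * (r - 1) / A" using A by (simp add: t_def X' A_def field_simps)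
  also have "\<dots> \<le> X * (1 / (q * k)) / A"
    using assms A r_le by (intro divide_right_mono mult_left_mono) auto
  finally have t_le: "t - 1 \<le> Y / (2 * q * k)" by (simp add: Y_def mult_ac)

  \<comment> \<open>\<open>t\<close> is the convex combination of 1 and \<open>r\<close> with weight
    \<open>X / A\<close>, so convexity of the power \<open>q\<close> brings in the exact value of
    \<open>r powr q\<close>.\<close>
  have "t = (1 - X / A) * 1 + X / A * r" using A by (simp add: t_def X' A_def field_simps)
  then have "t powr q \<le> (1 - X / A) * 1 powr q + X / A * r powr q"
    using convex_onD[OF powr_convex[of q], of "X / A" 1 r] assms q_gt_1 r
    by (simp add: A_def)
  also have "\<dots> = 1 + X / A / k" by (simp add: r algebra_simps)
  finally have "(t powr q) powr p \<le> (1 + X / A / k) powr p"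
    using p_gt_1 by (intro powr_mono2) auto
  also have "\<dots> \<le> Y powr (q - 1) * (1 + w) powr p"
    unfolding A_def Y_def using assms by (intro bound_step_factor) auto
  finally have key: "t powr (p * q) \<le> Y powr (q - 1) * (1 + w) powr p"
    by (simp add: powr_powr mult.commute)

  have "1 + (- p) * (t - 1) \<le> t powr - p"
    using t p_gt_1 by (intro powr_ge_tangent_nonpos) auto
  then have "1 - t powr - p \<le> p * (t - 1)" by simp
  also have "\<dots> \<le> p * (Y / (2 * q * k))"
    using t_le p_gt_1 by (intro mult_left_mono) auto
  \<comment> \<open>p / q = 1 / (q - 1) produces the coefficient of the recursion.\<close>
  also have "\<dots> = p / q * (Y / (2 * k))" by simp
  also have "\<dots> = 1 / (q - 1) * (Y / (2 * k))"
    by (simp only: exponent_identities)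
  finally have "2 * A powr - p * (1 - t powr - p) \<le> 2 * A powr - p * (1 / (q - 1) * (Y / (2 * k)))"
    by (intro mult_left_mono) auto
  also have "\<dots> = A powr - p / (k * (q - 1)) * Y"
    using a assms by (simp add: field_simps)
  also have "\<dots> \<le> A powr - p / (k * (q - 1)) * (Y powr q * (1 + w) powr p * t powr - (p * q))"
  proof (intro mult_left_mono)
    have "Y * t powr (p * q) \<le> Y * (Y powr (q - 1) * (1 + w) powr p)"
      using key Y by (intro mult_left_mono) auto
    then show "Y \<le> Y powr q * (1 + w) powr p * t powr - (p * q)"
      using t Y by (simp add: powr_diff powr_minus field_simps)
  qed (use a assms in auto)
  \<comment> \<open>The hypothesis on \<open>X powr q\<close> turns X^q (1 + w)^p / k back into w^q,
    and pq = p + q merges the powers of \<open>A\<close>.\<close>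
  also have "\<dots> = w powr q / (q - 1) * (2 * (1 + X') powr - p) powr q"
  proof -
    have "w powr q = X powr q * (1 + w) powr p / k"
      using assms by (simp add: powr_minus field_simps)
    moreover have "A powr (- (p * q)) = A powr - p * A powr - q"
      by (simp add: exponent_identities(1) flip: powr_add)
    ultimately show ?thesis
      using a assms A
      by (simp add: X'_A Y_def powr_mult powr_divide powr_powr powr_minus_divide mult_ac)
  qed
  finally show ?thesis
    by (simp add: X'_A powr_mult A_def[symmetric] algebra_simps)
qed

text \<open>The sequence is nonincreasing, so each of the first k decreases is at least
  \<open>c\<close> times the q-th power of the current value.\<close>

lemma implicit_total_decrease:
  assumes "\<And>k. 0 \<le> e k" "0 \<le> c"
    and step: "\<And>k. e (Suc k) + c * e (Suc k) powr q \<le> e k"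
  shows "e k + real k * c * e k powr q \<le> e 0"
proof (induction k)
  case (Suc k)
  have "0 \<le> c * e (Suc k) powr q" using assms by simp
  then have "e (Suc k) \<le> e k" using step[of k] by simp
  then have "e (Suc k) powr q \<le> e k powr q"
    using assms q_gt_1 by (intro powr_mono2) auto
  then have "real k * c * e (Suc k) powr q \<le> real k * c * e k powr q"
    using assms by (intro mult_left_mono) auto
  then show ?case using Suc step[of k] by (simp add: algebra_simps)
qed simp

lemma implicit_rate:
  assumes nonneg: "\<And>k. 0 \<le> e k" and "e 0 = 1" and w: "0 \<le> w"
    and step: "\<And>k. e (Suc k) + w powr q / (q - 1) * e (Suc k) powr q \<le> e k"
  shows "e k \<le> 2 * (1 + w * real k powr (1 / q) / (1 + w) powr (p - 1)) powr - p"
proof -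
  define c where "c = w powr q / (q - 1)"
  define X where "X k = w * real k powr (1 / q) / (1 + w) powr (p - 1)" for k
  have c: "0 \<le> c" using q_gt_1 by (simp add: c_def)
  have X: "0 \<le> X k" "X k powr q = w powr q * real k * (1 + w) powr - p" for k
    using quotient_powr[OF w, of "real k"] w by (simp_all add: X_def)
  have total: "e k + real k * c * e k powr q \<le> 1" for k
    using implicit_total_decrease[where e = e, OF nonneg c] step \<open>e 0 = 1\<close>
    unfolding c_def by metis
  show ?thesis
  proof (cases "w \<le> 1")
    case True
    have le_1: "e k \<le> 1" for k
      using total[of k] c by (smt (verit) mult_nonneg_nonneg of_nat_0_le_iff powr_ge_zero)
    show ?thesis
    proof (cases "e k = 0")
      case False
      then have "0 < e k" using nonneg[of k] by simp
      then have "1 + X k powr q \<le> e k powr - (q - 1)"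
      proof (induction k)
        case (Suc k)
        have "0 \<le> c * e (Suc k) powr q" using c by simp
        then have "0 < e k" using Suc.prems step[of k] by (simp add: c_def)
        then have "1 + X k powr q \<le> e k powr - (q - 1)" by (rule Suc.IH)
        moreover have "e k powr - (q - 1) + w powr q * (1 + w) powr - p \<le> e (Suc k) powr - (q - 1)"
          using implicit_step[OF Suc.prems le_1 w True step] .
        ultimately show ?case by (simp add: X(2) algebra_simps)
      qed (simp add: \<open>e 0 = 1\<close> X)
      then show ?thesis
        using le_bound_of_powr_ge[OF \<open>0 < e k\<close> X(1)] by (simp add: X_def)
    qed simp
  next
    case False
    have "e k \<le> 2 * (1 + X k) powr - p"
    proof (induction k)
      case 0
      show ?case using \<open>e 0 = 1\<close> by (simp add: X_def)
    next
      case (Suc k)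
      show ?case
      proof (cases "X (Suc k) \<le> w")
        case True
        then show ?thesis
          using bound_of_total_decrease[OF X(1) True _ X(2) nonneg] total[of "Suc k"]
          by (simp add: c_def)
      next
        case 2: False
        define G where "G = 2 * (1 + X (Suc k)) powr - p"
        \<comment> \<open>Cancelling w^q in the q-th powers turns \<open>X (Suc k) > w\<close> into
          a lower bound on k + 1.\<close>
        have "w powr q < X (Suc k) powr q"
          using 2 w q_gt_1 by (intro powr_less_mono2) auto
        then have "w powr q * 1 < w powr q * ((real k + 1) * (1 + w) powr - p)"
          by (simp add: X(2) mult_ac add.commute)
        then have "1 < (real k + 1) * (1 + w) powr - p"
          using w by (simp only: mult_less_cancel_left) auto
        then have large: "(1 + w) powr p < real k + 1"
          using w by (simp add: powr_minus field_simps)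
        \<comment> \<open>Together, k + 1 > 2; k is an integer, so it is at least 2.\<close>
        moreover have "2 powr 1 < (2 :: real) powr p"
          using p_gt_1 by (intro powr_less_mono) auto
        moreover have "2 powr p \<le> (1 + w) powr p"
          using False p_gt_1 by (intro powr_mono2) auto
        ultimately have k: "2 \<le> real k" by simp
        then have "2 * (1 + X k) powr - p \<le> G + c * G powr q"
          unfolding G_def c_def using False large
          by (intro bound_step[where k = "real k"])
             (auto simp: X(2) add.commute, auto simp: X_def)
        then have le: "e (Suc k) + c * e (Suc k) powr q \<le> G + c * G powr q"
          using step[of k] Suc by (simp add: c_def)
        \<comment> \<open>The map y -> y + c y^q is strictly increasing on nonnegative y, so the
          comparison of its values passes to the arguments.\<close>
        show ?thesis
        proof (rule ccontr)
          assume "\<not> ?thesis"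
          then have "G < e (Suc k)" by (simp add: G_def)
          moreover from this have "c * G powr q \<le> c * e (Suc k) powr q"
            using c q_gt_1 by (intro mult_left_mono powr_mono2) (auto simp: G_def)
          ultimately show False using le by linarith
        qed
      qed
    qed
    then show ?thesis by (simp add: X_def)
  qed
qed

end

section \<open>Exponential decay for p = infinity\<close>

lemma geometric_decay:
  fixes e :: "nat \<Rightarrow> real"
  assumes "\<And>k. e (Suc k) \<le> exp (- c) * e k"
  shows "e k \<le> e 0 * exp (- (c * real k))"
proof (induction k)
  case (Suc k)
  have "e (Suc k) \<le> exp (- c) * (e 0 * exp (- (c * real k)))"
    using assms[of k] Suc by (meson exp_ge_zero mult_left_mono order_trans)
  also have "\<dots> = e 0 * exp (- (c * real (Suc k)))"
    by (simp add: algebra_simps flip: exp_add)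
  finally show ?case .
qed simp

text \<open>With d = \<delta>/R and \<gamma> = e^d, an implicit step divides the gap by at least 1 +
  d, and the claimed rate is d/\<gamma>. The comparison is d e^(-d) \<le> d/(1 + d) \<le> ln (1 +
  d).\<close>

lemma exp_mult_exp_neg_le:
  fixes d :: real
  assumes "0 \<le> d"
  shows "exp (d * exp (- d)) \<le> 1 + d"
proof -
  have "exp (- d) \<le> 1 / (1 + d)"
    using assms exp_ge_add_one_self[of d] by (simp add: exp_minus field_simps)
  then have "d * exp (- d) \<le> d * (1 / (1 + d))" using assms by (intro mult_left_mono) auto
  also have "\<dots> = 1 - 1 / (1 + d)" using assms by (simp add: field_simps)
  also have "\<dots> \<le> ln (1 + d)"
    using ln_le_minus_one[of "1 / (1 + d)"] assms by (simp add: ln_div)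
  finally have "exp (d * exp (- d)) \<le> exp (ln (1 + d))" by (simp only: exp_le_cancel_iff)
  then show ?thesis using assms by simp
qed

section \<open>Duality of the norms induced by \<open>B\<close>, and the gradient inequality\<close>

context
  fixes B :: "'a::real_normed_vector \<Rightarrow> ('a \<Rightarrow>\<^sub>L real)"
  assumes B: "pos_def_self_adjoint B"
begin

lemma B_linear: "linear B"
  and B_sym: "blinfun_apply (B u) v = blinfun_apply (B v) u"
  and B_pos: "v \<noteq> 0 \<Longrightarrow> 0 < blinfun_apply (B v) v"
  using B by (auto simp: pos_def_self_adjoint_def)

lemma B_nonneg: "0 \<le> blinfun_apply (B v) v"
  using B_pos[of v] by (cases "v = 0") auto

lemmas B_simps = linear_add[OF B_linear] linear_diff[OF B_linear] linear_scale[OF B_linear]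
  blinfun.bilinear_simps

lemma B_Cauchy_Schwarz: "blinfun_apply (B u) v \<le> primal_norm B u * primal_norm B v"
proof (cases "v = 0")
  case False
  define t where "t = blinfun_apply (B u) v / blinfun_apply (B v) v"
  have v: "0 < blinfun_apply (B v) v" using False B_pos by simp
  have "0 \<le> blinfun_apply (B (u - t *\<^sub>R v)) (u - t *\<^sub>R v)" by (rule B_nonneg)
  also have "\<dots> = blinfun_apply (B u) u - (blinfun_apply (B u) v)\<^sup>2 / blinfun_apply (B v) v"
    using v by (simp add: B_simps B_sym[of v u] t_def power2_eq_square field_simps)
  finally have "(blinfun_apply (B u) v)\<^sup>2 \<le> blinfun_apply (B u) u * blinfun_apply (B v) v"
    using v by (simp add: field_simps)
  then have "blinfun_apply (B u) v \<le> sqrt (blinfun_apply (B u) u * blinfun_apply (B v) v)"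
    by (rule real_le_rsqrt)
  then show ?thesis by (simp add: primal_norm_def real_sqrt_mult)
qed (simp add: primal_norm_def)

text \<open>Riesz representation by Gram-Schmidt. The induction hypothesis for \<open>B b\<close>
  provides the \<open>B\<close>-orthogonal projection \<open>y\<close> of the new vector; the
  representer \<open>z\<close> on the old span is then corrected along \<open>n = b - y\<close>.
  Hence the induction is over all functionals.\<close>

lemma functional_representable_on_span:
  assumes "finite S"
  shows "\<exists>z\<in>span S. \<forall>v\<in>span S. blinfun_apply (B z) v = blinfun_apply s v"
  using assms
proof (induction S arbitrary: s rule: finite_induct)
  case (insert b S)
  obtain z where z: "z \<in> span S" "\<forall>v\<in>span S. blinfun_apply (B z) v = blinfun_apply s v"
    using insert.IH[of s] by blast
  obtain y where y: "y \<in> span S" "\<forall>v\<in>span S. blinfun_apply (B y) v = blinfun_apply (B b) v"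
    using insert.IH[of "B b"] by blast
  define n where "n = b - y"
  define t where "t = blinfun_apply s n / blinfun_apply (B n) n"
  have orth: "blinfun_apply (B n) v = 0" if "v \<in> span S" for v
    using y that by (simp add: n_def B_simps)
  have span: "span S \<subseteq> span (insert b S)" by (intro span_mono) auto
  have n: "n \<in> span (insert b S)"
    unfolding n_def using y span by (intro span_diff) (auto intro: span_base)
  \<comment> \<open>If \<open>n = 0\<close>, both sides vanish.\<close>
  have tn: "t * blinfun_apply (B n) n = blinfun_apply s n"
    using B_pos[of n] by (cases "n = 0") (auto simp: t_def blinfun.zero_right)
  show ?case
  proof (intro bexI ballI)
    show "z + t *\<^sub>R n \<in> span (insert b S)"
      using z n span by (intro span_add span_scale) auto
    fix v assume "v \<in> span (insert b S)"
    then obtain k where "v - k *\<^sub>R b \<in> span S" by (auto simp: span_breakdown_eq)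
    then have "(v - k *\<^sub>R b) + k *\<^sub>R y \<in> span S"
      using y by (intro span_add span_scale) auto
    then have u: "v - k *\<^sub>R n \<in> span S" by (simp add: n_def algebra_simps)
    define u where "u = v - k *\<^sub>R n"
    have v: "v = u + k *\<^sub>R n" by (simp add: u_def)
    have "blinfun_apply (B z) n = 0" using orth[OF z(1)] by (simp add: B_sym[of z])
    moreover have "blinfun_apply (B n) u = 0" "blinfun_apply (B z) u = blinfun_apply s u"
      using orth z u by (auto simp: u_def)
    ultimately show "blinfun_apply (B (z + t *\<^sub>R n)) v = blinfun_apply s v"
      unfolding v by (simp add: B_simps flip: tn)
  qed
qed (simp add: blinfun.zero_right)

text \<open>Gives \<open>B (inv B s) = s\<close>, by which \<open>dual_norm B s\<close> is the
  primal norm of \<open>inv B s\<close>.\<close>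

lemma B_surj:
  assumes "finite_dimensional TYPE('a)"
  shows "surj B"
proof -
  obtain S :: "'a set" where S: "finite S" "span S = UNIV"
    using assms by (auto simp: finite_dimensional_def)
  show ?thesis
  proof (rule surjI[of B "\<lambda>s. SOME z. B z = s"])
    fix s
    obtain z where "\<forall>v. blinfun_apply (B z) v = blinfun_apply s v"
      using functional_representable_on_span[OF S(1), of s] S(2) by auto
    then have "B z = s" by (intro blinfun_eqI) simp
    then show "B (SOME z. B z = s) = s" by (rule someI)
  qed
qed

lemma dual_norm_nonneg:
  assumes "finite_dimensional TYPE('a)"
  shows "0 \<le> dual_norm B s"
  using B_nonneg[of "inv B s"] surj_f_inv_f[OF B_surj[OF assms], of s]
  by (simp add: dual_norm_def)

lemma dual_norm_bound:
  assumes "finite_dimensional TYPE('a)"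
  shows "blinfun_apply s v \<le> dual_norm B s * primal_norm B v"
  using B_Cauchy_Schwarz[of "inv B s" v] surj_f_inv_f[OF B_surj[OF assms], of s]
  by (simp add: dual_norm_def primal_norm_def)

lemma primal_norm_pos: "v \<noteq> 0 \<Longrightarrow> 0 < primal_norm B v"
  by (simp add: primal_norm_def B_pos)

end

text \<open>Restriction to the line through \<open>x\<close> and \<open>y\<close> reduces this to
  the tangent inequality in one variable.\<close>

lemma convex_ge_gradient:
  fixes f :: "'a::real_normed_vector \<Rightarrow> real"
  assumes "convex_on UNIV f" and deriv: "(f has_derivative f') (at x)"
  shows "f x + f' (y - x) \<le> f y"
proof -
  define g where "g t = f (x + t *\<^sub>R (y - x))" for t :: real
  have "convex_on UNIV g"
  proof (rule convex_onI)
    fix t a b :: real assume t: "0 < t" "t < 1"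
    have "x + ((1 - t) *\<^sub>R a + t *\<^sub>R b) *\<^sub>R (y - x)
        = (1 - t) *\<^sub>R (x + a *\<^sub>R (y - x)) + t *\<^sub>R (x + b *\<^sub>R (y - x))"
      by (simp add: algebra_simps)
    then show "g ((1 - t) *\<^sub>R a + t *\<^sub>R b) \<le> (1 - t) * g a + t * g b"
      using convex_onD[OF assms(1), of t] t by (simp add: g_def)
  qed simp
  moreover have "(f has_derivative f') (at (x + 0 *\<^sub>R (y - x)))" using deriv by simp
  then have "(g has_derivative (\<lambda>t. f' (t *\<^sub>R (y - x)))) (at 0)"
    unfolding g_def
    by (rule has_derivative_compose[rotated]) (auto intro!: derivative_eq_intros)
  then have "(g has_real_derivative f' (y - x)) (at 0)"
    using has_derivative_linear[OF deriv]
    by (simp add: has_field_derivative_def linear_scale mult.commute[of _ "f' _"])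
  ultimately have "g 1 - g 0 \<ge> f' (y - x) * (1 - 0)"
    by (intro convex_on_imp_above_tangent[where A = UNIV]) auto
  then show ?thesis by (simp add: g_def)
qed

section \<open>The constants of the bound in normalised form\<close>

lemma (in conjugate_exponents) c_const_powr:
  "c_const p powr (1 / p) * p = (q - 1) powr - (1 / q)"
proof -
  have pq: "0 < p" "0 < q" "0 < q - 1" using p_gt_1 q_gt_1 by auto
  have inv: "1 - 1 / p = 1 / q" "p - 1 = 1 / (q - 1)"
    using exponent_identities(1) exponent_identities(5) pq by (simp_all add: field_simps)
  \<comment> \<open>Written in q, the constant becomes a power of q - 1, since p / q = 1 / (q - 1)
    too; this is the source of the factor q - 1 in \<open>w\<close>.\<close>
  have "c_const p = (1 / q) powr p * (q - 1)"
    by (simp add: c_const_def inv)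
  then have "c_const p powr (1 / p) = 1 / q * (q - 1) powr (1 / p)"
    using pq by (simp add: powr_mult powr_powr)
  then have "c_const p powr (1 / p) * p = (q - 1) powr (1 / p) * (p / q)" by simp
  also have "p / q = (q - 1) powr - 1"
    using pq exponent_identities(5,6) by (simp add: powr_minus_divide)
  also have "(q - 1) powr (1 / p) * (q - 1) powr - 1 = (q - 1) powr (1 / p - 1)"
    by (simp only: powr_add[symmetric]) simp
  also have "1 / p - 1 = - (1 / q)" using inv(1) by linarith
  finally show ?thesis .
qed

lemma conjugate_exponents_quotient:
  assumes "1 < r"
  shows "conjugate_exponents r (r / (r - 1))"
  using assms by unfold_locales (simp_all add: field_simps)

text \<open>E0^(-1/p) is pulled out of the bracket; the outer power -p turns it into
  \<open>E0\<close>.\<close>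

lemma (in conjugate_exponents) rate_bound_eq:
  assumes "0 < E0" "0 < R" "0 < \<gamma>" "0 < \<delta>"
    and w: "w = E0 powr (1 / p) * ((q - 1) * \<delta>) powr (1 / q) / R"
  shows "rate_bound E0 R \<gamma> \<delta> (ereal p) k
    = E0 * (2 * (1 + w * real k powr (1 / q) / \<gamma>) powr - p)"
proof -
  have pq: "0 < p" "0 < q" "0 < q - 1" "(p - 1) / p = 1 / q"
    using p_gt_1 q_gt_1 exponent_identities(1) by (auto simp: field_simps)
  have c: "R * \<gamma> * c_const p powr (1 / p) * p = R * \<gamma> * (q - 1) powr - (1 / q)"
    using c_const_powr by (simp add: mult.assoc)
  have "1 / E0 powr (1 / p)
      + 1 / (R * \<gamma> * c_const p powr (1 / p) * p) * (\<delta> * real k) powr ((p - 1) / p)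
    = E0 powr - (1 / p) * (1 + w * real k powr (1 / q) / \<gamma>)"
    unfolding c pq(4) w powr_mult using assms(1-4) pq(1-3)
    by (simp add: powr_minus_divide distrib_left)
  then have "rate_bound E0 R \<gamma> \<delta> (ereal p) k
      = 2 * (E0 powr - (1 / p) * (1 + w * real k powr (1 / q) / \<gamma>)) powr - p"
    using assms by (simp add: rate_bound_def)
  also have "\<dots> = E0 * (2 * (1 + w * real k powr (1 / q) / \<gamma>) powr - p)"
    using assms pq by (simp add: powr_mult powr_powr)
  finally show ?thesis .
qed

text \<open>By \<open>c_const_powr\<close>, the summand next to 1 in the implicit \<gamma> is
  \<open>w\<close> itself.\<close>

lemma (in conjugate_exponents) implicit_gamma_eq:
  assumes "0 < E0" "0 < R" "0 < \<delta>"
    and w: "w = E0 powr (1 / p) * ((q - 1) * \<delta>) powr (1 / q) / R"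
  shows "implicit_gamma E0 R \<delta> (ereal p) = (1 + w) powr (p - 1)"
proof -
  have pq: "0 < p" "0 < q" "0 < q - 1" "(p - 1) / p = 1 / q"
    using p_gt_1 q_gt_1 exponent_identities(1) by (auto simp: field_simps)
  have "1 / (R * p) * (E0 / c_const p) powr (1 / p) * \<delta> powr (1 / q)
      = E0 powr (1 / p) * \<delta> powr (1 / q) / R / (c_const p powr (1 / p) * p)"
    by (simp add: powr_divide)
  also have "\<dots> = w"
    unfolding c_const_powr w using assms pq by (simp add: powr_minus_divide powr_mult)
  finally show ?thesis unfolding implicit_gamma_def by (simp add: pq(4))
qed

text \<open>The choice of \<open>w\<close> is made for this identity: q / p = q - 1, so w^q absorbs
  \<open>\<delta>\<close>, \<open>R\<close> and the powers of \<open>E0\<close>.\<close>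

lemma (in conjugate_exponents) normalised_decrease:
  assumes "0 < E0" "0 < R" "0 < \<delta>" "0 \<le> E"
    and w: "w = E0 powr (1 / p) * ((q - 1) * \<delta>) powr (1 / q) / R"
  shows "\<delta> * (E / R) powr q / E0 = w powr q / (q - 1) * (E / E0) powr q"
proof -
  have pq: "0 < p" "0 < q" "0 < q - 1" using p_gt_1 q_gt_1 by auto
  have "w powr q = E0 powr (q - 1) * ((q - 1) * \<delta>) / R powr q"
    unfolding w using assms pq exponent_identities(7)
    by (simp add: powr_mult powr_divide powr_powr)
  then show ?thesis
    using assms pq by (simp add: powr_divide powr_diff)
qed

text \<open>With \<open>K\<close> the larger of E0^(1/r) and c_r^(1/r), the bracket of the bound is
  at least (1 + Y)/K. So C = 2 K^r depends on \<open>E0\<close> and \<open>r\<close> only.\<close>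

lemma rate_bound_le_rate_order:
  assumes "0 \<le> E0" "1 < r"
  shows "\<exists>C. \<forall>R \<gamma> \<delta> k. 0 < R \<longrightarrow> 0 < \<gamma> \<longrightarrow> 0 < \<delta> \<longrightarrow>
    rate_bound E0 R \<gamma> \<delta> (ereal r) k \<le> C * rate_order R \<gamma> \<delta> r k"
proof (cases "E0 = 0")
  case True
  then show ?thesis by (intro exI[of _ 0]) (simp add: rate_bound_def)
next
  case False
  define K where "K = max (E0 powr (1 / r)) (c_const r powr (1 / r))"
  have c: "0 < c_const r" using assms by (simp add: c_const_def)
  have E0: "0 < E0" using False assms by simp
  have K: "0 < K" "E0 powr (1 / r) \<le> K" "c_const r powr (1 / r) \<le> K"
    using E0 by (simp_all add: K_def less_max_iff_disj)
  show ?thesis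
  proof (intro exI[of _ "2 * K powr r"] allI impI)
    fix R \<gamma> \<delta> :: real and k :: nat
    assume pos: "0 < R" "0 < \<gamma>" "0 < \<delta>"
    define Y where "Y = 1 / (R * \<gamma> * r) * (\<delta> * real k) powr ((r - 1) / r)"
    define Z where "Z = 1 / E0 powr (1 / r) + Y / c_const r powr (1 / r)"
    have Y: "0 \<le> Y" using pos assms by (simp add: Y_def)
    have "1 \<le> K / E0 powr (1 / r)" "1 \<le> K / c_const r powr (1 / r)"
      using K E0 c by simp_all
    then have "1 + Y \<le> K / E0 powr (1 / r) + K / c_const r powr (1 / r) * Y"
      using Y mult_right_mono[of 1 "K / c_const r powr (1 / r)" Y] by (intro add_mono) auto
    also have "\<dots> = K * Z" by (simp add: Z_def algebra_simps)
    finally have KZ: "(K * Z) powr - r \<le> (1 + Y) powr - r"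
      using assms Y by (intro powr_mono2') auto
    have "Z = 1 / E0 powr (1 / r)
        + 1 / (R * \<gamma> * c_const r powr (1 / r) * r) * (\<delta> * real k) powr ((r - 1) / r)"
      by (simp add: Z_def Y_def mult_ac)
    then have "rate_bound E0 R \<gamma> \<delta> (ereal r) k = 2 * Z powr - r"
      using False by (simp add: rate_bound_def)
    also have "\<dots> = 2 * K powr r * (K * Z) powr - r"
      using K by (simp add: powr_mult powr_minus_divide)
    also have "\<dots> \<le> 2 * K powr r * (1 + Y) powr - r"
      using KZ by (intro mult_left_mono) auto
    also have "\<dots> = 2 * K powr r * rate_order R \<gamma> \<delta> r k"
      by (simp add: rate_order_def Y_def powr_minus_divide)
    finally show "rate_bound E0 R \<gamma> \<delta> (ereal r) k \<le> 2 * K powr r * rate_order R \<gamma> \<delta> r k" .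
  qed
qed

section \<open>Rate bounds for the sequence of gaps\<close>

lemma explicit_rate_bound:
  fixes E :: "nat \<Rightarrow> real"
  assumes p: "1 < p" and "0 < \<delta>" "0 < R" and "0 < E 0"
    and nonneg: "\<And>k. 0 \<le> E k"
    and step: "\<And>k. E (Suc k) \<le> E k - \<delta> * (E k / R) powr conj_exponent p"
  shows "E k \<le> rate_bound (E 0) R 1 \<delta> p k"
proof (cases p)
  case (real r)
  then have "1 < r" using p by simp
  define q where "q = r / (r - 1)"
  interpret conjugate_exponents r q
    unfolding q_def using \<open>1 < r\<close> by (rule conjugate_exponents_quotient)
  define w where "w = E 0 powr (1 / r) * ((q - 1) * \<delta>) powr (1 / q) / R"
  have "E k / E 0 \<le> 2 * (1 + w * real k powr (1 / q)) powr - r"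
  proof (rule explicit_rate)
    fix k
    have "E (Suc k) / E 0 \<le> (E k - \<delta> * (E k / R) powr q) / E 0"
      using step[of k] assms(4) real by (intro divide_right_mono) (auto simp: conj_exponent_def q_def)
    then show "E (Suc k) / E 0 \<le> E k / E 0 - w powr q / (q - 1) * (E k / E 0) powr q"
      using normalised_decrease[OF assms(4,3,2) nonneg w_def] by (simp add: diff_divide_distrib)
  qed (use assms nonneg in \<open>auto simp: w_def\<close>)
  then show ?thesis
    unfolding real rate_bound_eq[OF assms(4,3) zero_less_one assms(2) w_def]
    using assms(4) by (simp add: field_simps)
next
  case PInf
  have "E (Suc k) \<le> exp (- (\<delta> / R)) * E k" for k
  proof -
    \<comment> \<open>For p = infinity the exponent is 1 and the recursion is linear. Its factor may
      be negative but never exceeds the exponential.\<close>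
    have "E (Suc k) \<le> (1 + - (\<delta> / R)) * E k"
      using step[of k] nonneg[of k] assms PInf by (simp add: conj_exponent_def algebra_simps)
    also have "\<dots> \<le> exp (- (\<delta> / R)) * E k"
      using nonneg by (intro mult_right_mono exp_ge_add_one_self) auto
    finally show ?thesis .
  qed
  from geometric_decay[of E, OF this] have "E k \<le> E 0 * exp (- (\<delta> / R * real k))" .
  \<comment> \<open>For p = infinity the factor 2 of the bound is pure slack.\<close>
  also have "\<dots> \<le> 2 * (E 0 * exp (- (\<delta> / R * real k)))" using assms by simp
  finally show ?thesis using assms PInf by (simp add: rate_bound_def)
qed (use p in simp)

lemma implicit_rate_bound:
  fixes E :: "nat \<Rightarrow> real"
  assumes p: "1 < p" and "0 < \<delta>" "0 < R" and "0 < E 0"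
    and nonneg: "\<And>k. 0 \<le> E k"
    and step: "\<And>k. E (Suc k) + \<delta> * (E (Suc k) / R) powr conj_exponent p \<le> E k"
  shows "E k \<le> rate_bound (E 0) R (implicit_gamma (E 0) R \<delta> p) \<delta> p k"
proof (cases p)
  case (real r)
  then have "1 < r" using p by simp
  define q where "q = r / (r - 1)"
  interpret conjugate_exponents r q
    unfolding q_def using \<open>1 < r\<close> by (rule conjugate_exponents_quotient)
  define w where "w = E 0 powr (1 / r) * ((q - 1) * \<delta>) powr (1 / q) / R"
  have w: "0 \<le> w" using assms by (simp add: w_def)
  have "E k / E 0 \<le> 2 * (1 + w * real k powr (1 / q) / (1 + w) powr (r - 1)) powr - r"
  proof (rule implicit_rate)
    fix k
    have "(E (Suc k) + \<delta> * (E (Suc k) / R) powr q) / E 0 \<le> E k / E 0"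
      using step[of k] assms(4) real by (intro divide_right_mono) (auto simp: conj_exponent_def q_def)
    then show "E (Suc k) / E 0 + w powr q / (q - 1) * (E (Suc k) / E 0) powr q \<le> E k / E 0"
      using normalised_decrease[OF assms(4,3,2) nonneg w_def] by (simp add: add_divide_distrib)
  qed (use assms nonneg w in auto)
  \<comment> \<open>\<open>rate_bound_eq\<close> asks for a positive \<gamma>.\<close>
  moreover have "0 < (1 + w) powr (r - 1)" using w by simp
  ultimately show ?thesis
    unfolding real implicit_gamma_eq[OF assms(4,3,2) w_def]
    using assms(4) rate_bound_eq[OF assms(4,3) _ assms(2) w_def]
    by (simp add: field_simps)
next
  case PInf
  define d where "d = \<delta> / R"
  have d: "0 < d" using assms by (simp add: d_def)
  have "E (Suc k) \<le> exp (- (d * exp (- d))) * E k" for k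
  proof -
    have "E (Suc k) * exp (d * exp (- d)) \<le> E (Suc k) * (1 + d)"
      using d nonneg by (intro mult_left_mono exp_mult_exp_neg_le) auto
    also have "\<dots> \<le> E k"
      using step[of k] nonneg[of "Suc k"] assms PInf by (simp add: conj_exponent_def d_def algebra_simps)
    finally show ?thesis by (simp add: exp_minus field_simps)
  qed
  from geometric_decay[of E, OF this] have "E k \<le> E 0 * exp (- (d * exp (- d) * real k))" .
  also have "\<dots> \<le> 2 * (E 0 * exp (- (d * exp (- d) * real k)))" using assms by simp
  finally show ?thesis
    using assms PInf by (simp add: rate_bound_def implicit_gamma_def d_def exp_minus field_simps)
qed (use p in simp)

section \<open>From convexity and descent to the scalar recursion\<close>

theorem theorem2:
  fixes B :: "'a::real_normed_vector \<Rightarrow> ('a \<Rightarrow>\<^sub>L real)"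
    and f :: "'a \<Rightarrow> real" and f' :: "'a \<Rightarrow> ('a \<Rightarrow>\<^sub>L real)"
    and A :: "'a \<Rightarrow> 'a" and x :: "nat \<Rightarrow> 'a" and xstar :: 'a
    and p :: ereal and \<delta> E0 R \<gamma> :: real
  assumes findim: "finite_dimensional TYPE('a)"
    and B: "pos_def_self_adjoint B"
    and convex: "convex_on UNIV f"
    and deriv: "\<And>y. (f has_derivative blinfun_apply (f' y)) (at y)"
    and cont: "continuous_on UNIV f'"
    and minimum: "\<And>y. f xstar \<le> f y"
    and p: "1 < p" and \<delta>: "0 < \<delta>"
    and iterates: "\<And>k. x (Suc k) = A (x k)"
    and E0: "E0 = f (x 0) - f xstar"
    and R_finite: "bdd_above ((\<lambda>y. primal_norm B (y - xstar)) ` {y. f y \<le> f (x 0)})"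
    and R: "R = (SUP y\<in>{y. f y \<le> f (x 0)}. primal_norm B (y - xstar))"
    and descent: "(explicit_descent B f f' \<delta> p x \<and> \<gamma> = 1) \<or>
                  (implicit_descent B f f' \<delta> p x \<and> \<gamma> = implicit_gamma E0 R \<delta> p)"
  shows "(\<forall>k. f (x k) - f xstar \<le> rate_bound E0 R \<gamma> \<delta> p k) \<and>
    (p < \<infinity> \<longrightarrow>
      (\<lambda>k. rate_bound E0 R \<gamma> \<delta> p k) \<in> O(\<lambda>k. rate_order R \<gamma> \<delta> (real_of_ereal p) k) \<and>
      (\<exists>C. \<forall>R' \<gamma>' \<delta>' k. 0 < R' \<longrightarrow> 0 < \<gamma>' \<longrightarrow> 0 < \<delta>' \<longrightarrow>
         rate_bound E0 R' \<gamma>' \<delta>' p k \<le> C * rate_order R' \<gamma>' \<delta>' (real_of_ereal p) k))"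
proof -
  define E where "E k = f (x k) - f xstar" for k
  have E_nonneg: "0 \<le> E k" for k using minimum by (simp add: E_def)
  have E0_eq: "E0 = E 0" by (simp add: E0 E_def)
  \<comment> \<open>Either condition bounds the quotient by a nonpositive number, so all iterates
    stay in the initial sublevel set, to which \<open>R\<close> refers.\<close>
  have "E (Suc k) \<le> E k" for k
  proof -
    have "(f (x (Suc k)) - f (x k)) / \<delta> \<le> 0"
      using descent unfolding explicit_descent_def implicit_descent_def
      by (meson neg_le_0_iff_le order_trans powr_ge_zero)
    then show ?thesis using \<delta> by (simp add: E_def divide_le_0_iff)
  qed
  then have "decseq E" by (rule decseq_SucI)
  then have E_le: "E k \<le> E 0" for k by (rule decseqD) simp
  have R_upper: "primal_norm B (y - xstar) \<le> R" if "f y \<le> f (x 0)" for y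
    unfolding R using that by (intro cSUP_upper[OF _ R_finite]) auto
  have E_le_R: "E k \<le> R * dual_norm B (f' (x k))" for k
  proof -
    have "E k \<le> blinfun_apply (f' (x k)) (x k - xstar)"
      using convex_ge_gradient[OF convex deriv, of "x k" xstar]
      by (simp add: E_def blinfun.diff_right)
    also have "\<dots> \<le> dual_norm B (f' (x k)) * primal_norm B (x k - xstar)"
      by (rule dual_norm_bound[OF B findim])
    also have "\<dots> \<le> dual_norm B (f' (x k)) * R"
      using E_le[of k] by (intro mult_left_mono R_upper dual_norm_nonneg[OF B findim]) (simp add: E_def)
    finally show ?thesis by (simp add: mult.commute)
  qed
  \<comment> \<open>A nonzero initial gap separates \<open>x 0\<close> from \<open>xstar\<close>,
    and \<open>x 0\<close> lies in the sublevel set.\<close>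
  have R_pos: "0 < R" if "E0 \<noteq> 0"
  proof -
    have "x 0 - xstar \<noteq> 0" using that E0 by auto
    from primal_norm_pos[OF B this] show ?thesis using R_upper[of "x 0"] by simp
  qed
  have grad: "\<delta> * (E k / R) powr conj_exponent p \<le> \<delta> * dual_norm B (f' (x k)) powr conj_exponent p"
    if "E0 \<noteq> 0" for k
  proof (intro mult_left_mono powr_mono2)
    show "0 \<le> conj_exponent p"
      using p by (cases p) (auto simp: conj_exponent_def)
    show "E k / R \<le> dual_norm B (f' (x k))"
      using E_le_R[of k] R_pos[OF that] by (simp add: pos_divide_le_eq mult.commute)
  qed (use \<delta> E_nonneg R_pos[OF that] in auto)
  have bound: "E k \<le> rate_bound E0 R \<gamma> \<delta> p k" for k
  proof (cases "E0 = 0")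
    case True
    \<comment> \<open>By monotonicity the gap stays at most 0, the value of the bound here.\<close>
    then show ?thesis using E_le[of k] by (simp add: rate_bound_def E0_eq)
  next
    case False
    then have E0_pos: "0 < E 0" using E_nonneg[of 0] by (simp add: E0_eq)
    from descent show ?thesis
    proof
      assume *: "explicit_descent B f f' \<delta> p x \<and> \<gamma> = 1"
      have "E (Suc k) \<le> E k - \<delta> * (E k / R) powr conj_exponent p" for k
      proof -
        have "E (Suc k) - E k \<le> - (\<delta> * dual_norm B (f' (x k)) powr conj_exponent p)"
          using * \<delta> by (simp add: explicit_descent_def E_def pos_divide_le_eq mult.commute)
        then show ?thesis using grad[OF False, of k] by linarith
      qed
      from explicit_rate_bound[of p \<delta> R E, OF p \<delta> R_pos[OF False] E0_pos E_nonneg this]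
      show ?thesis using * by (simp add: E0_eq)
    next
      assume *: "implicit_descent B f f' \<delta> p x \<and> \<gamma> = implicit_gamma E0 R \<delta> p"
      have "E (Suc k) + \<delta> * (E (Suc k) / R) powr conj_exponent p \<le> E k" for k
      proof -
        have "E (Suc k) - E k \<le> - (\<delta> * dual_norm B (f' (x (Suc k))) powr conj_exponent p)"
          using * \<delta> by (simp add: implicit_descent_def E_def pos_divide_le_eq mult.commute)
        then show ?thesis using grad[OF False, of "Suc k"] by linarith
      qed
      from implicit_rate_bound[of p \<delta> R E, OF p \<delta> R_pos[OF False] E0_pos E_nonneg this]
      show ?thesis using * by (simp add: E0_eq)
    qed
  qed
  have order: "(\<lambda>k. rate_bound E0 R \<gamma> \<delta> p k) \<in> O(\<lambda>k. rate_order R \<gamma> \<delta> (real_of_ereal p) k) \<and>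
      (\<exists>C. \<forall>R' \<gamma>' \<delta>' k. 0 < R' \<longrightarrow> 0 < \<gamma>' \<longrightarrow> 0 < \<delta>' \<longrightarrow>
         rate_bound E0 R' \<gamma>' \<delta>' p k \<le> C * rate_order R' \<gamma>' \<delta>' (real_of_ereal p) k)"
    if "p < \<infinity>"
  proof -
    obtain r where r: "p = ereal r" "1 < r" using p \<open>p < \<infinity>\<close> by (cases p) auto
    \<comment> \<open>One constant, uniform in all parameters, serves both the big-O claim and the
      uniform claim.\<close>
    obtain C where C: "rate_bound E0 R' \<gamma>' \<delta>' p k \<le> C * rate_order R' \<gamma>' \<delta>' r k"
      if "0 < R'" "0 < \<gamma>'" "0 < \<delta>'" for R' \<gamma>' \<delta>' k
      using rate_bound_le_rate_order[of E0 r] E_nonneg[of 0] unfolding r(1) E0_eq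
      by (metis r(2))
    have "(\<lambda>k. rate_bound E0 R \<gamma> \<delta> p k) \<in> O(\<lambda>k. rate_order R \<gamma> \<delta> r k)"
    \<comment> \<open>If \<open>E0 = 0\<close>, then \<open>R\<close> may be 0, but the bound is
      constantly 0.\<close>
    proof (cases "E0 = 0")
      case True
      then show ?thesis by (simp add: rate_bound_def)
    next
      case False
      have "0 < 1 + 1 / (R * r) * (E0 / c_const r) powr (1 / r) * \<delta> powr ((r - 1) / r)"
        using R_pos[OF False] r by (intro add_pos_nonneg) auto
      then have "0 < \<gamma>"
        using descent r by (auto simp: implicit_gamma_def)
      show ?thesis
      proof (intro bigoI[of _ C] always_eventually allI)
        fix k
        have "0 \<le> rate_bound E0 R \<gamma> \<delta> p k" using False r by (simp add: rate_bound_def Let_def)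
        moreover have "0 \<le> rate_order R \<gamma> \<delta> r k" by (simp add: rate_order_def)
        ultimately show "norm (rate_bound E0 R \<gamma> \<delta> p k) \<le> C * norm (rate_order R \<gamma> \<delta> r k)"
          using C[OF R_pos[OF False] \<open>0 < \<gamma>\<close> \<delta>, of k] by simp
      qed
    qed
    then show ?thesis using C unfolding r real_of_ereal.simps by blast
  qed
  show ?thesis using bound order unfolding E_def by blast
qed

end
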